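(* Let $P(q)=P_1(q)P_2(q)\cdots P_k(q)$ be a product of $q$-binomial coefficients $P_i(q)=\binom{m_i+n_i}{m_i,n_i}_q$, with $m_i,n_i\ge1$. Then there exists a rooted tree $T$ with $Q(T)=P(q)$ if and only if the numerator of $P(q)$ (in reduced form) does not repeat any $q$-integer.
   Context: Notation: $[k]_q=1+q+\dots+q^{k-1}$, $[k]_q!=[k]_q\cdots[1]_q$, $\binom{m+n}{m,n}_q=\frac{[m+n]_q!}{[m]_q!\,[n]_q!}$. A polynomial written as $P(q)=\frac{[a_1]_q\cdots[a_s]_q}{[b_1]_q\cdots[b_l]_q}$ (with all $a_i,b_j\ge 2$, since $[1]_q=1$) is in reduced form if $a_i\ne b_j$ for all $i,j$; the reduced form is unique. The numerator $N(P(q))$ is the (formal) product $[a_1]_q\cdots[a_s]_q$ of the reduced form; it does not repeat any $q$-integer if $a_1,\dots,a_s$ are pairwise distinct. Plucking polynomial: trees are finite and grow up from the root. For a plane rooted tree $T$, $Q(T,q)=1$ if $T$ is a single vertex; otherwise $Q(T,q)=\sum_{v}q^{r(T,v)}Q(T-v,q)$, the sum over all leaves $v$ (vertices of degree $1$ other than the root), where $r(T,v)$ is the number of edges of $T$ to the right of the unique path joining $v$ to the root. It is known that $Q(T)$ does not depend on the plane embedding, so it is an invariant of rooted trees. *)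

theory Defs
  imports Complex_Main "HOL-Library.Multiset" "HOL-Computational_Algebra.Polynomial"
begin

section \<open>q-analogues\<close>

text \<open>Polynomials in \<open>q\<close> are integer polynomials; \<open>q\<close> is the monomial of degree one.\<close>

definition qint :: "nat \<Rightarrow> int poly" where
  "qint k = (\<Sum>i<k. monom 1 i)"

definition qfact :: "nat \<Rightarrow> int poly" where
  "qfact k = (\<Prod>i=1..k. qint i)"

text \<open>The polynomial division is exact, see \<open>qbinom_mult_qfact\<close> below.\<close>

definition qbinom :: "nat \<Rightarrow> nat \<Rightarrow> int poly" where
  "qbinom m n = qfact (m + n) div (qfact m * qfact n)"

lemma qint_add: "qint (m + n) = qint m + monom 1 m * qint n"
  by (induction n) (simp_all add: qint_def distrib_left mult_monom)

lemma poly_qint_1: "poly (qint k) 1 = int k"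
  by (simp add: qint_def poly_sum poly_monom)

lemma qint_nonzero: "k > 0 \<Longrightarrow> qint k \<noteq> 0"
  using poly_qint_1[of k] by auto

lemma qfact_nonzero: "qfact k \<noteq> 0"
  by (simp add: qfact_def qint_nonzero)

lemma qfact_Suc: "qfact (Suc k) = qint (Suc k) * qfact k"
  by (simp add: qfact_def mult.commute)

lemma qfact_dvd: "qfact m * qfact n dvd qfact (m + n)"
proof (induction "m + n" arbitrary: m n rule: less_induct)
  case less
  show ?case
  proof (cases "m = 0 \<or> n = 0")
    case True
    then show ?thesis by (auto simp: qfact_def)
  next
    case False
    then obtain a b where ab: "m = Suc a" "n = Suc b"
      by (metis not0_implies_Suc)
    have 1: "qfact m * qfact n dvd qint m * qfact (a + n)"
      using less[of a n] ab by (simp add: qfact_Suc mult.assoc mult_dvd_mono)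
    have 2: "qfact m * qfact n dvd qint n * qfact (m + b)"
      using less[of m b] ab mult_dvd_mono[of "qint n" "qint n"]
      by (simp add: qfact_Suc mult.left_commute[of _ "qint (Suc b)"])
    have "qfact (m + n) = qint (m + n) * qfact (a + n)"
      using ab qfact_Suc[of "a + n"] by simp
    also have "\<dots> = qint m * qfact (a + n) + monom 1 m * (qint n * qfact (m + b))"
      using ab qfact_Suc[of "m + b"] unfolding qint_add by (simp add: distrib_right mult.assoc)
    finally show ?thesis
      using 1 2 by (simp add: dvd_mult)
  qed
qed

lemma qbinom_mult_qfact: "qbinom m n * (qfact m * qfact n) = qfact (m + n)"
  using qfact_dvd[of m n] by (simp add: qbinom_def)


section \<open>Reduced form and numerator\<close>

text \<open>
  A formal product of q-integers is the multiset of its indices.  In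
  \<open>reduced_form P A B\<close> the multisets \<open>A\<close> and \<open>B\<close> are the indices of the numerator and of
  the denominator; the fraction is written in cross-multiplied form.
\<close>

definition qint_prod :: "nat multiset \<Rightarrow> int poly" where
  "qint_prod A = prod_mset (image_mset qint A)"

definition reduced_form :: "int poly \<Rightarrow> nat multiset \<Rightarrow> nat multiset \<Rightarrow> bool" where
  "reduced_form P A B \<longleftrightarrow>
     (\<forall>a\<in>#A. a \<ge> 2) \<and> (\<forall>b\<in>#B. b \<ge> 2) \<and> (\<forall>a\<in>#A. \<forall>b\<in>#B. a \<noteq> b) \<and>
     P * qint_prod B = qint_prod A"

definition numerator :: "int poly \<Rightarrow> nat multiset" where
  "numerator P = (THE A. \<exists>B. reduced_form P A B)"

definition repeats_no_qint :: "nat multiset \<Rightarrow> bool" where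
  "repeats_no_qint A \<longleftrightarrow> (\<forall>a. count A a \<le> 1)"

lemma qint_prod_add: "qint_prod (A + B) = qint_prod A * qint_prod B"
  by (simp add: qint_prod_def)

lemma qint_prod_nonzero: "0 \<notin># A \<Longrightarrow> qint_prod A \<noteq> 0"
  by (induction A) (auto simp: qint_prod_def qint_nonzero)

definition eval_complex :: "int poly \<Rightarrow> complex \<Rightarrow> complex" where
  "eval_complex p z = poly (map_poly of_int p) z"

lemma eval_complex_0 [simp]: "eval_complex 0 z = 0"
  by (simp add: eval_complex_def)

lemma eval_complex_pCons: "eval_complex (pCons a p) z = of_int a + z * eval_complex p z"
  by (cases "a = 0 \<and> p = 0") (auto simp: eval_complex_def map_poly_pCons)

lemma eval_complex_add: "eval_complex (p + q) z = eval_complex p z + eval_complex q z"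
  by (induction p q rule: poly_induct2) (simp_all add: eval_complex_pCons algebra_simps)

lemma eval_complex_smult: "eval_complex (smult c p) z = of_int c * eval_complex p z"
  by (induction p) (simp_all add: eval_complex_pCons algebra_simps)

lemma eval_complex_mult: "eval_complex (p * q) z = eval_complex p z * eval_complex q z"
  by (induction p)
    (simp_all add: eval_complex_pCons eval_complex_add eval_complex_smult algebra_simps)

lemma eval_complex_monom: "eval_complex (monom 1 i) z = z ^ i"
  by (induction i) (simp_all add: eval_complex_pCons monom_0 monom_Suc)

lemma eval_qint: "eval_complex (qint k) z = (\<Sum>i<k. z ^ i)"
  by (induction k) (simp_all add: qint_def eval_complex_add eval_complex_monom)

lemma eval_qint_prod:
  "eval_complex (qint_prod A) z = 0 \<longleftrightarrow> (\<exists>a\<in>#A. eval_complex (qint a) z = 0)"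
proof (induction A)
  case empty
  then show ?case
    using eval_complex_monom[of 0 z] by (simp add: qint_prod_def)
qed (auto simp: qint_prod_def eval_complex_mult)

lemma eval_qint_primitive_root:
  assumes "a \<ge> 2" and "0 < b" and "b \<le> a"
  shows "eval_complex (qint b) (cis (2 * pi / real a)) = 0 \<longleftrightarrow> b = a"
proof -
  define z where "z = cis (2 * pi / real a)"
  have inj: "inj_on (\<lambda>k. cis (2 * pi * real k / real a)) {..<a}"
    using bij_betw_roots_unity[of a] assms by (simp add: bij_betw_def)
  have pow: "z ^ k = cis (2 * pi * real k / real a)" for k
    by (simp add: z_def DeMoivre mult.commute)
  have ne: "z ^ k \<noteq> 1" if "0 < k" "k < a" for k
    using inj_onD[OF inj, of k 0] that by (auto simp: pow)
  have z1: "z \<noteq> 1"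
    using ne[of 1] assms by simp
  have "z ^ a = 1"
    using assms by (simp add: pow)
  then have "z ^ b = 1 \<longleftrightarrow> b = a"
    using ne[of b] assms by (cases "b = a") auto
  then show ?thesis
    using z1 by (simp add: z_def[symmetric] eval_qint sum_gp_strict)
qed

lemma qint_prod_inject:
  assumes "qint_prod M = qint_prod N"
    and "\<forall>a\<in>#M. a \<ge> 2" and "\<forall>a\<in>#N. a \<ge> 2"
  shows "M = N"
  using assms
proof (induction "size M" arbitrary: M N rule: less_induct)
  case less
  show ?case
  proof (cases "M + N = {#}")
    case True
    then show ?thesis by simp
  next
    case False
    define a where "a = Max (set_mset (M + N))"
    have aMN: "a \<in># M + N"
      unfolding a_def by (rule Max_in) (use False in auto)
    have a2: "a \<ge> 2"
      using aMN less.prems by auto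
    have le: "b \<le> a" if "b \<in># M + N" for b
      using that unfolding a_def by (intro Max_ge) auto
    define \<zeta> where "\<zeta> = cis (2 * pi / real a)"
    have in_iff: "a \<in># K \<longleftrightarrow> eval_complex (qint_prod K) \<zeta> = 0"
      if K: "K \<subseteq># M + N" "\<forall>b\<in>#K. b \<ge> 2" for K
    proof -
      have "eval_complex (qint b) \<zeta> = 0 \<longleftrightarrow> b = a" if "b \<in># K" for b
        using K that le[of b] a2 mset_subset_eqD[OF K(1) that]
        by (auto simp: \<zeta>_def eval_qint_primitive_root)
      then show ?thesis
        by (auto simp: eval_qint_prod)
    qed
    have "a \<in># M \<longleftrightarrow> a \<in># N"
      using in_iff[of M] in_iff[of N] less.prems by simp
    then have "a \<in># M" "a \<in># N"
      using aMN by auto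
    then obtain M' N' where MN: "M = add_mset a M'" "N = add_mset a N'"
      by (meson multi_member_split)
    have "qint_prod M' = qint_prod N'"
      using less.prems(1) a2 by (simp add: MN qint_prod_def qint_nonzero)
    then have "M' = N'"
      using less by (auto simp: MN)
    then show ?thesis by (simp add: MN)
  qed
qed

lemma reduced_form_unique:
  assumes "reduced_form P A B" and "reduced_form P A' B'"
  shows "A = A' \<and> B = B'"
proof -
  have eq: "P * qint_prod B = qint_prod A" "P * qint_prod B' = qint_prod A'"
    and ge: "\<forall>a\<in>#A. a \<ge> 2" "\<forall>b\<in>#B. b \<ge> 2" "\<forall>a\<in>#A'. a \<ge> 2" "\<forall>b\<in>#B'. b \<ge> 2"
    and ne: "\<forall>a\<in>#A. a \<notin># B" "\<forall>a\<in>#A'. a \<notin># B'"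
    using assms by (auto simp: reduced_form_def)
  have "qint_prod (A + B') = qint_prod (A' + B)"
    by (simp add: qint_prod_add eq[symmetric] mult_ac)
  then have sum: "A + B' = A' + B"
    by (rule qint_prod_inject) (use ge in auto)
  have count: "count A a = count A' a \<and> count B a = count B' a" for a
  proof -
    have "count A a + count B' a = count A' a + count B a"
      using arg_cong[OF sum, of "\<lambda>M. count M a"] by simp
    moreover have "count A a = 0 \<or> count B a = 0" "count A' a = 0 \<or> count B' a = 0"
      using ne by (meson count_eq_zero_iff)+
    ultimately show ?thesis by auto
  qed
  then show ?thesis by (auto intro: multiset_eqI)
qed

lemma reduced_form_exists:
  assumes "P * qint_prod B = qint_prod A" and "0 \<notin># A" and "0 \<notin># B"
  shows "\<exists>A' B'. reduced_form P A' B'"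
proof -
  define F where "F = filter_mset (\<lambda>a. a \<ge> (2::nat))"
  have F: "qint_prod (F M) = qint_prod M" if "0 \<notin># M" for M
    using that
  proof (induction M)
    case (add a M)
    then show ?case
      by (cases "a = 1") (auto simp: F_def qint_prod_def qint_def)
  qed (simp add: F_def)
  define A' B' where "A' = F A - F B" and "B' = F B - F A"
  have AB: "F A = A' + F A \<inter># F B" "F B = B' + F A \<inter># F B"
    by (auto simp: A'_def B'_def multiset_eq_iff)
  have "P * qint_prod (F B) = qint_prod (F A)"
    using assms F by simp
  then have "P * qint_prod B' * qint_prod (F A \<inter># F B) = qint_prod A' * qint_prod (F A \<inter># F B)"
    by (metis AB mult.assoc qint_prod_add)
  moreover have "qint_prod (F A \<inter># F B) \<noteq> 0"
    by (rule qint_prod_nonzero) (simp add: F_def)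
  ultimately have "P * qint_prod B' = qint_prod A'"
    by simp
  moreover have "\<forall>a\<in>#A'. a \<ge> 2" "\<forall>b\<in>#B'. b \<ge> 2"
    by (auto simp: A'_def B'_def F_def dest!: in_diffD)
  moreover have "\<forall>a\<in>#A'. \<forall>b\<in>#B'. a \<noteq> b"
    by (auto simp: A'_def B'_def in_diff_count)
  ultimately show ?thesis
    unfolding reduced_form_def by blast
qed

lemma numerator_eq: "reduced_form P A B \<Longrightarrow> numerator P = A"
  unfolding numerator_def by (rule the_equality) (blast dest: reduced_form_unique)+


section \<open>Rooted trees and the plucking polynomial\<close>

text \<open>The list of subtrees of a plane rooted tree is ordered from left to right.\<close>

datatype plane_tree = Node "plane_tree list"

datatype rooted_tree = RNode "rooted_tree multiset"

primrec forget_embedding :: "plane_tree \<Rightarrow> rooted_tree" where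
  "forget_embedding (Node ts) = RNode (mset (map forget_embedding ts))"

fun num_edges :: "plane_tree \<Rightarrow> nat" where
  "num_edges (Node ts) = (\<Sum>t\<leftarrow>ts. Suc (num_edges t))"

text \<open>
  A vertex is addressed by the list of child positions on the path from the root to it.
  The single vertex \<open>Node []\<close> is given the leaf \<open>[]\<close> only for the sake of the recursion;
  in a tree with an edge, the root is never in \<open>leaves\<close>, even if it has degree one.
\<close>

lemma size_nth_less [termination_simp]: "i < length ts \<Longrightarrow> size (ts ! i) < Suc (size_list size ts)"
  using size_list_estimation'[of "ts ! i" ts "size (ts ! i)" size] by (simp add: less_Suc_eq_le)

fun leaves :: "plane_tree \<Rightarrow> nat list set" where
  "leaves (Node ts) = (if ts = [] then {[]} else (\<Union>i<length ts. (#) i ` leaves (ts ! i)))"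

fun edges_right :: "plane_tree \<Rightarrow> nat list \<Rightarrow> nat" where
  "edges_right t [] = 0"
| "edges_right (Node ts) (i # v) =
     edges_right (ts ! i) v + (\<Sum>t\<leftarrow>drop (Suc i) ts. Suc (num_edges t))"

fun pluck :: "plane_tree \<Rightarrow> nat list \<Rightarrow> plane_tree" where
  "pluck t [] = t"
| "pluck (Node ts) [i] = Node (take i ts @ drop (Suc i) ts)"
| "pluck (Node ts) (i # v) = Node (ts[i := pluck (ts ! i) v])"

lemma num_edges_pluck:
  assumes "v \<in> leaves t" and "v \<noteq> []"
  shows "Suc (num_edges (pluck t v)) = num_edges t"
  using assms
proof (induction t v rule: pluck.induct)
  case (1 t)
  then show ?case by simp
next
  case (2 ts i)
  then have i: "i < length ts" and "[] \<in> leaves (ts ! i)"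
    by (auto split: if_splits)
  then have "ts ! i = Node []"
    by (cases "ts ! i") (auto split: if_splits)
  moreover have "num_edges (Node ts) =
      num_edges (Node (take i ts)) + Suc (num_edges (ts ! i)) + num_edges (Node (drop (Suc i) ts))"
    using arg_cong[OF id_take_nth_drop[OF i], of "\<lambda>ts. num_edges (Node ts)"] by simp
  ultimately show ?case by simp
next
  case (3 ts i j v)
  then have i: "i < length ts" and v: "j # v \<in> leaves (ts ! i)"
    by (auto split: if_splits)
  have "num_edges (Node ts) =
      num_edges (Node (take i ts)) + Suc (num_edges (ts ! i)) + num_edges (Node (drop (Suc i) ts))"
    using arg_cong[OF id_take_nth_drop[OF i], of "\<lambda>ts. num_edges (Node ts)"] by simp
  moreover have "num_edges (Node (ts[i := t])) =
      num_edges (Node (take i ts)) + Suc (num_edges t) + num_edges (Node (drop (Suc i) ts))" for t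
    using i by (simp add: upd_conv_take_nth_drop)
  ultimately show ?case
    using 3 v by simp
qed

function plane_plucking_poly :: "plane_tree \<Rightarrow> int poly" where
  "plane_plucking_poly t =
     (if t = Node [] then 1
      else \<Sum>v\<in>leaves t. monom 1 (edges_right t v) * plane_plucking_poly (pluck t v))"
  by auto
termination
proof (relation "measure num_edges")
  fix t v
  assume "t \<noteq> Node []" and v: "v \<in> leaves t"
  then have "v \<noteq> []"
    by (cases t) (auto split: if_splits)
  then show "(pluck t v, t) \<in> measure num_edges"
    using num_edges_pluck[OF v] by simp
qed simp

declare plane_plucking_poly.simps [simp del]

lemma surj_forget_embedding: "\<exists>t. forget_embedding t = T"
proof (induction T)
  case (RNode M)
  then obtain g where g: "\<And>T. T \<in># M \<Longrightarrow> forget_embedding (g T) = T"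
    by metis
  obtain Ts where Ts: "mset Ts = M"
    using ex_mset by blast
  have "map forget_embedding (map g Ts) = Ts"
    using g Ts by (auto intro!: map_idI)
  then have "forget_embedding (Node (map g Ts)) = RNode M"
    by (simp only: forget_embedding.simps Ts)
  then show ?case ..
qed

text \<open>The plane polynomial does not depend on the embedding, so any embedding may be chosen.\<close>

definition plucking_poly :: "rooted_tree \<Rightarrow> int poly" where
  "plucking_poly T = plane_plucking_poly (SOME t. forget_embedding t = T)"

end

theory Submission
  imports Defs
begin

text \<open>
  The plucking polynomial satisfies the hook length formula \<open>Q(T) \<cdot> \<Prod> [h(v)] = [e(T)]!\<close>, where
  \<open>h(v)\<close> is the number of vertices of the subtree at \<open>v\<close> and \<open>v\<close> ranges over the vertices other
  than the root.  So the numerator of \<open>Q(T)\<close> is part of \<open>[1] \<cdots> [e(T)]\<close> and has no repetition.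

  Conversely, treat the binomials in decreasing order of \<open>m + n\<close>, starting from one large slot;
  a binomial takes a slot of size at least \<open>m + n\<close> and leaves two slots \<open>m\<close> and
  \<open>n\<close>.  The number of slots of size at least \<open>x\<close> is one minus the exponent of \<open>[x]\<close> in the
  product treated so far.  If \<open>x = m + n\<close> is the sum of the next binomial, all later binomials
  have exponent \<open>\<ge> 0\<close> at \<open>[x]\<close> and this one has exponent 1, so if there were no slot, \<open>[x]\<close> would be
  repeated in the numerator.  Trees filling the slots \<open>m\<close> and \<open>n\<close> are glued at their
  roots, which contributes the binomial, and put on a stem to fill the larger slot.
\<close>

section \<open>The hook length formula\<close>

primrec rt_edges :: "rooted_tree \<Rightarrow> nat" where
  "rt_edges (RNode M) = sum_mset (image_mset (\<lambda>T. Suc (rt_edges T)) M)"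

text \<open>Defined on trees without embedding, so that two embeddings of one tree have the same
  hook product at once.\<close>

primrec hooks :: "rooted_tree \<Rightarrow> nat multiset" where
  "hooks (RNode M) = sum_mset (image_mset (\<lambda>T. add_mset (Suc (rt_edges T)) (hooks T)) M)"

lemma rt_edges_forget_embedding: "rt_edges (forget_embedding t) = num_edges t"
proof (induction t)
  case (Node ts)
  then show ?case
    by (induction ts) auto
qed

lemma hooks_pos: "0 \<notin># hooks T"
  by (induction T) auto

definition hook_prod :: "plane_tree \<Rightarrow> int poly" where
  "hook_prod t = qint_prod (hooks (forget_embedding t))"

lemma hook_prod_nonzero: "hook_prod t \<noteq> 0"
  by (simp add: hook_prod_def qint_prod_nonzero hooks_pos)

lemma hook_prod_Nil: "hook_prod (Node []) = 1"
  by (simp add: hook_prod_def qint_prod_def)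

lemma hook_prod_Cons:
  "hook_prod (Node (t # ts)) = qint (Suc (num_edges t)) * hook_prod t * hook_prod (Node ts)"
  by (simp add: hook_prod_def qint_prod_def rt_edges_forget_embedding mult_ac)

lemma hook_prod_append:
  "hook_prod (Node (ts @ us)) = hook_prod (Node ts) * hook_prod (Node us)"
  by (induction ts) (simp_all add: hook_prod_Nil hook_prod_Cons mult_ac)

lemma hook_prod_split:
  assumes "i < length ts"
  shows "hook_prod (Node ts) = hook_prod (Node (take i ts @ drop (Suc i) ts)) *
    (qint (Suc (num_edges (ts ! i))) * hook_prod (ts ! i))"
proof -
  have "hook_prod (Node ts) = hook_prod (Node (take i ts @ ts ! i # drop (Suc i) ts))"
    using assms by (simp add: id_take_nth_drop[symmetric])
  then show ?thesis
    by (simp add: hook_prod_append hook_prod_Cons mult_ac)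
qed

lemma hook_prod_update:
  assumes "i < length ts"
  shows "hook_prod (Node (ts[i := t])) = hook_prod (Node (take i ts @ drop (Suc i) ts)) *
    (qint (Suc (num_edges t)) * hook_prod t)"
  using assms by (simp add: upd_conv_take_nth_drop hook_prod_append hook_prod_Cons mult_ac)

lemma finite_leaves: "finite (leaves t)"
  by (induction t rule: leaves.induct) auto

lemma Nil_in_leaves_iff: "[] \<in> leaves t \<longleftrightarrow> t = Node []"
  by (cases t) auto

lemma qint_1 [simp]: "qint (Suc 0) = 1"
  by (simp add: qint_def)

lemma monom_1_add: "monom (1 :: int) (a + b) = monom 1 a * monom 1 b"
  by (simp add: mult_monom)

text \<open>Read from right to left, the branches with their root edges cut the exponents below the
  edge count into consecutive blocks.\<close>

lemma qint_num_edges: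
  "(\<Sum>i<length ts. monom 1 (\<Sum>t\<leftarrow>drop (Suc i) ts. Suc (num_edges t)) * qint (Suc (num_edges (ts ! i))))
    = qint (num_edges (Node ts))"
proof (induction ts)
  case Nil
  then show ?case by (simp add: qint_def)
next
  case (Cons t ts)
  have "qint (num_edges (Node (t # ts))) = qint (num_edges (Node ts) + Suc (num_edges t))"
    by (simp add: add.commute)
  also have "\<dots> = qint (num_edges (Node ts)) +
      monom 1 (num_edges (Node ts)) * qint (Suc (num_edges t))"
    by (rule qint_add)
  also have "qint (num_edges (Node ts)) =
      (\<Sum>i<length ts. monom 1 (\<Sum>t\<leftarrow>drop (Suc i) ts. Suc (num_edges t)) * qint (Suc (num_edges (ts ! i))))"
    by (rule Cons.IH[symmetric])
  finally show ?case
    by (simp add: sum.lessThan_Suc_shift add.commute del: sum.lessThan_Suc)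
qed

text \<open>
  This is \<open>\<Sum>\<^sub>v q\<^bsup>r(t,v)\<^esup> \<cdot> H(t) / H(t - v) = [e(t)]\<close> for the hook product \<open>H\<close>, written without
  division: \<open>g v\<close> stands for \<open>c / H(t - v)\<close>.
\<close>

lemma sum_leaves_hook_prod:
  assumes "t \<noteq> Node []" and "\<And>v. v \<in> leaves t \<Longrightarrow> g v * hook_prod (pluck t v) = c"
  shows "(\<Sum>v\<in>leaves t. monom 1 (edges_right t v) * g v) * hook_prod t = qint (num_edges t) * c"
  using assms
proof (induction t arbitrary: g rule: leaves.induct)
  case (1 ts)
  have ts: "ts \<noteq> []"
    using 1 by simp
  define K where "K i = hook_prod (Node (take i ts @ drop (Suc i) ts))" for i
  define R where "R i = (\<Sum>t\<leftarrow>drop (Suc i) ts. Suc (num_edges t))" for i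
  define B where "B i = (\<Sum>v\<in>leaves (ts ! i). monom 1 (edges_right (ts ! i) v) * g (i # v))" for i
  \<comment> \<open>The leaves of one branch; the edges in the branches to its right are accounted
    for by \<open>R i\<close>.\<close>
  have branch: "B i * hook_prod (Node ts) = qint (Suc (num_edges (ts ! i))) * c"
    if i: "i < length ts" for i
  proof (cases "ts ! i = Node []")
    case True
    \<comment> \<open>Plucking \<open>[i]\<close> removes the whole branch, a case outside the
      induction hypothesis.\<close>
    have "[i] \<in> leaves (Node ts)"
      using i ts True by (auto simp: image_iff)
    then have "g [i] * K i = c"
      using 1(3)[of "[i]"] by (simp add: K_def)
    then show ?thesis
      using True hook_prod_split[OF i]
      by (simp add: B_def K_def[symmetric] hook_prod_Nil monom_0)
  next
    case False
    define e where "e = num_edges (ts ! i)"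
    obtain u us where "ts ! i = Node (u # us)"
      using False by (metis neq_Nil_conv plane_tree.exhaust)
    then have e: "e > 0"
      by (simp add: e_def)
    \<comment> \<open>Plucking inside branch \<open>i\<close> keeps the hooks in \<open>K i\<close>
      and lowers the hook of the branch from \<open>Suc e\<close> to \<open>e\<close>; the weights
      absorb both factors.\<close>
    have IH: "(\<Sum>v\<in>leaves (ts ! i). monom 1 (edges_right (ts ! i) v) * (g (i # v) * (K i * qint e)))
        * hook_prod (ts ! i) = qint e * c"
      unfolding e_def
    proof (rule 1(1)[OF ts _ False])
      show "i \<in> {..<length ts}" using i by simp
      fix v assume v: "v \<in> leaves (ts ! i)"
      then have vne: "v \<noteq> []"
        using False Nil_in_leaves_iff by auto
      then have "pluck (Node ts) (i # v) = Node (ts[i := pluck (ts ! i) v])"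
        by (cases v) auto
      moreover have "i # v \<in> leaves (Node ts)"
        using i ts v by auto
      ultimately have "g (i # v) * hook_prod (Node (ts[i := pluck (ts ! i) v])) = c"
        using 1(3)[of "i # v"] by simp
      then show "g (i # v) * (K i * qint (num_edges (ts ! i))) * hook_prod (pluck (ts ! i) v) = c"
        using hook_prod_update[OF i] num_edges_pluck[OF v vne] by (simp add: K_def mult_ac)
    qed
    have "qint e * (B i * (K i * hook_prod (ts ! i))) = qint e * c"
      unfolding IH[symmetric] B_def sum_distrib_left sum_distrib_right by (simp add: mult_ac)
    then have "B i * (K i * hook_prod (ts ! i)) = c"
      using e by (simp add: qint_nonzero)
    then show ?thesis
      using hook_prod_split[OF i] by (simp add: K_def[symmetric] e_def[symmetric] mult_ac)
  qed
  have "(\<Sum>v\<in>leaves (Node ts). monom 1 (edges_right (Node ts) v) * g v)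
      = (\<Sum>i<length ts. \<Sum>v\<in>(#) i ` leaves (ts ! i). monom 1 (edges_right (Node ts) v) * g v)"
    using ts by (simp, intro sum.UNION_disjoint) (auto simp: finite_leaves)
  also have "\<dots> = (\<Sum>i<length ts. monom 1 (R i) * B i)"
  proof (rule sum.cong[OF refl])
    fix i
    show "(\<Sum>v\<in>(#) i ` leaves (ts ! i). monom 1 (edges_right (Node ts) v) * g v) = monom 1 (R i) * B i"
      by (subst sum.reindex) (simp_all add: B_def R_def sum_distrib_left monom_1_add mult_ac)
  qed
  finally have "(\<Sum>v\<in>leaves (Node ts). monom 1 (edges_right (Node ts) v) * g v) * hook_prod (Node ts)
      = (\<Sum>i<length ts. monom 1 (R i) * (B i * hook_prod (Node ts)))"
    by (simp add: sum_distrib_right mult.assoc)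
  also have "\<dots> = (\<Sum>i<length ts. monom 1 (R i) * qint (Suc (num_edges (ts ! i)))) * c"
    by (simp add: branch sum_distrib_right mult.assoc)
  finally show ?case
    by (simp only: R_def qint_num_edges)
qed

text \<open>Induction on the number of edges: the polynomials of the plucked trees serve as the
  weights \<open>g\<close>, and \<open>c\<close> is the factorial for one edge fewer.\<close>

lemma plane_plucking_poly_hook_prod:
  "plane_plucking_poly t * hook_prod t = qfact (num_edges t)"
proof (induction "num_edges t" arbitrary: t rule: less_induct)
  case less
  show ?case
  proof (cases "t = Node []")
    case True
    then show ?thesis
      by (simp add: plane_plucking_poly.simps hook_prod_Nil qfact_def)
  next
    case False
    then obtain e where e: "num_edges t = Suc e"
      by (cases t rule: num_edges.cases) (auto simp: neq_Nil_conv)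
    have "plane_plucking_poly (pluck t v) * hook_prod (pluck t v) = qfact e"
      if v: "v \<in> leaves t" for v
    proof -
      have "v \<noteq> []"
        using v False Nil_in_leaves_iff by auto
      then show ?thesis
        using num_edges_pluck[OF v] less[of "pluck t v"] e by simp
    qed
    then show ?thesis
      using sum_leaves_hook_prod[OF False, of "\<lambda>v. plane_plucking_poly (pluck t v)"] False e
      by (simp add: plane_plucking_poly.simps[of t] qfact_Suc)
  qed
qed

text \<open>Embeddings of one tree share hook product and edge count, and the nonzero hook product
  cancels.\<close>

lemma plucking_poly_forget_embedding:
  "plucking_poly (forget_embedding t) = plane_plucking_poly t"
proof -
  define t' where "t' = (SOME t'. forget_embedding t' = forget_embedding t)"
  have t': "forget_embedding t' = forget_embedding t"
    unfolding t'_def by (rule someI) (rule refl)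
  then have "hook_prod t' = hook_prod t" "num_edges t' = num_edges t"
    by (simp_all add: hook_prod_def flip: rt_edges_forget_embedding)
  then have "plane_plucking_poly t' * hook_prod t = plane_plucking_poly t * hook_prod t"
    by (metis plane_plucking_poly_hook_prod)
  then show ?thesis
    by (simp add: plucking_poly_def t'_def[symmetric] hook_prod_nonzero)
qed

section \<open>Gluing at the root and adding a stem\<close>

lemma plane_plucking_poly_append:
  "plane_plucking_poly (Node (ts @ us)) =
    qbinom (num_edges (Node ts)) (num_edges (Node us)) *
      (plane_plucking_poly (Node ts) * plane_plucking_poly (Node us))"
proof -
  let ?H = "hook_prod (Node ts) * hook_prod (Node us)"
  \<comment> \<open>Gluing at the root unites the hooks, so only the factorials differ.\<close>
  have "plane_plucking_poly (Node (ts @ us)) * ?H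
      = qfact (num_edges (Node ts) + num_edges (Node us))"
    using plane_plucking_poly_hook_prod[of "Node (ts @ us)"] by (simp add: hook_prod_append)
  also have "\<dots> = qbinom (num_edges (Node ts)) (num_edges (Node us)) *
      (plane_plucking_poly (Node ts) * plane_plucking_poly (Node us)) * ?H"
    unfolding qbinom_mult_qfact[symmetric] plane_plucking_poly_hook_prod[symmetric]
    by (simp only: mult_ac)
  finally show ?thesis
    by (simp add: hook_prod_nonzero)
qed

text \<open>The stem adds the hook \<open>Suc (num_edges t)\<close>, which is also the new factor of
  the factorial.\<close>

lemma plane_plucking_poly_stem: "plane_plucking_poly (Node [t]) = plane_plucking_poly t"
proof -
  let ?H = "qint (Suc (num_edges t)) * hook_prod t"
  have "plane_plucking_poly (Node [t]) * ?H = qfact (Suc (num_edges t))"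
    using plane_plucking_poly_hook_prod[of "Node [t]"] by (simp add: hook_prod_Cons hook_prod_Nil)
  also have "\<dots> = plane_plucking_poly t * ?H"
    unfolding qfact_Suc plane_plucking_poly_hook_prod[symmetric] by (simp only: mult_ac)
  finally show ?thesis
    by (simp add: hook_prod_nonzero qint_nonzero)
qed

lemma stem_exists:
  assumes "num_edges t \<le> p"
  shows "\<exists>u. num_edges u = p \<and> plane_plucking_poly u = plane_plucking_poly t"
  using assms
proof (induction p rule: dec_induct)
  case (step p)
  then obtain u where "num_edges u = p" "plane_plucking_poly u = plane_plucking_poly t"
    by blast
  then show ?case
    by (intro exI[of _ "Node [u]"]) (simp add: plane_plucking_poly_stem)
qed blast


section \<open>Repetition in the numerator\<close>

lemma qint_prod_ge_2:
  assumes "0 \<notin># M"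
  shows "qint_prod (filter_mset (\<lambda>a. a \<ge> 2) M) = qint_prod M"
  using assms
proof (induction M)
  case (add a M)
  then show ?case
    by (cases "a = 1") (auto simp: qint_prod_def)
qed simp

text \<open>From index 2 on, the counts satisfy \<open>A + D = B + C\<close>; as \<open>A\<close>
  and \<open>B\<close> are disjoint, those of \<open>A\<close> are the truncated differences of
  \<open>C\<close> and \<open>D\<close>.\<close>

lemma repeats_no_qint_numerator_iff:
  assumes eq: "P * qint_prod D = qint_prod C" and C: "0 \<notin># C" and D: "0 \<notin># D"
  shows "repeats_no_qint (numerator P) \<longleftrightarrow> (\<forall>a\<ge>2. count C a \<le> count D a + 1)"
proof -
  obtain A B where AB: "reduced_form P A B"
    using reduced_form_exists[OF eq C D] by blast
  then have PB: "P * qint_prod B = qint_prod A"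
    and ge: "\<forall>a\<in>#A. a \<ge> 2" "\<forall>b\<in>#B. b \<ge> 2" and disj: "\<forall>a\<in>#A. a \<notin># B"
    by (auto simp: reduced_form_def)
  let ?F = "filter_mset (\<lambda>a. a \<ge> (2::nat))"
  have "qint_prod (A + ?F D) = qint_prod (B + ?F C)"
    by (simp add: qint_prod_add qint_prod_ge_2 C D eq[symmetric] PB[symmetric] mult_ac)
  then have sum: "A + ?F D = B + ?F C"
    by (rule qint_prod_inject) (use ge in auto)
  have count: "count A a + count D a = count B a + count C a" if "a \<ge> 2" for a
    using arg_cong[OF sum, of "\<lambda>M. count M a"] that by simp
  have "(\<forall>a. count A a \<le> 1) \<longleftrightarrow> (\<forall>a\<ge>2. count C a \<le> count D a + 1)"
  proof
    assume *: "\<forall>a. count A a \<le> 1"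
    show "\<forall>a\<ge>2. count C a \<le> count D a + 1"
    proof (intro allI impI)
      fix a :: nat assume "a \<ge> 2"
      then show "count C a \<le> count D a + 1"
        using count[of a] *[rule_format, of a] by linarith
    qed
  next
    assume *: "\<forall>a\<ge>2. count C a \<le> count D a + 1"
    show "\<forall>a. count A a \<le> 1"
    proof
      fix a
      show "count A a \<le> 1"
      proof (cases "a \<in># A")
        case True
        then have "a \<ge> 2" "count B a = 0"
          using ge disj by (auto simp: count_eq_zero_iff)
        then show ?thesis
          using count[of a] *[rule_format, of a] by linarith
      qed (simp add: count_eq_zero_iff[THEN iffD2])
    qed
  qed
  then show ?thesis
    by (simp add: numerator_eq[OF AB] repeats_no_qint_def)
qed

lemma qfact_eq_qint_prod: "qfact k = qint_prod (mset_set {1..k})"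
  by (simp add: qfact_def qint_prod_def prod_unfold_prod_mset)


section \<open>Filling slots with trees\<close>

text \<open>\<open>S\<close> holds the free slots. The induction needs several of them, since each
  binomial replaces one slot by two.\<close>

lemma trees_fill_slots:
  fixes m n :: "'i \<Rightarrow> nat"
  assumes "finite I" and "\<And>i. i \<in> I \<Longrightarrow> m i \<ge> 1 \<and> n i \<ge> 1"
    and "\<And>x. x \<ge> 2 \<Longrightarrow> card {i\<in>I. x \<le> m i + n i} \<le>
      card {i\<in>I. x \<le> m i} + card {i\<in>I. x \<le> n i} + size (filter_mset (\<lambda>s. x \<le> s) S)"
  shows "\<exists>F. image_mset num_edges F = S \<and>
    prod_mset (image_mset plane_plucking_poly F) = (\<Prod>i\<in>I. qbinom (m i) (n i))"
  using assms
\<comment> \<open>Each inserted \<open>j\<close> has the largest sum \<open>m j + n j\<close> so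
  far.\<close>
proof (induction I arbitrary: S rule: finite_ranking_induct[where f = "\<lambda>i. m i + n i"])
  case empty
  \<comment> \<open>Slots left over are filled with paths.\<close>
  have "\<forall>s. \<exists>u. num_edges u = s \<and> plane_plucking_poly u = 1"
    using stem_exists[of "Node []"] by (simp add: plane_plucking_poly.simps[of "Node []"])
  then obtain path where "\<And>s. num_edges (path s) = s \<and> plane_plucking_poly (path s) = 1"
    by metis
  then show ?case
    by (intro exI[of _ "image_mset path S"]) (simp add: multiset.map_comp comp_def)
next
  case (insert j I)
  show ?case
  proof (cases "j \<in> I")
    \<comment> \<open>The induction rule does not guarantee that \<open>j\<close> is new.\<close>
    case True
    then show ?thesis
      using insert.IH[of S] insert.prems by (simp add: insert_absorb)
  next
    case j: False
    have card_insert: "card {i\<in>insert j I. Q i} = card {i\<in>I. Q i} + (if Q j then 1 else 0)" for Q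
    proof -
      have "{i\<in>insert j I. Q i} = (if Q j then insert j {i\<in>I. Q i} else {i\<in>I. Q i})"
        by auto
      then show ?thesis
        using j insert.hyps(1) by simp
    qed
    have mn: "m j \<ge> 1" "n j \<ge> 1"
      using insert.prems(1) by auto
    \<comment> \<open>Both parts are positive, so each is smaller than its sum, which is at most
      \<open>m j + n j\<close>.\<close>
    have empty: "{i\<in>I. m j + n j \<le> m i} = {}" "{i\<in>I. m j + n j \<le> n i} = {}"
      using insert.hyps(2) insert.prems(1) by fastforce+
    have "Suc (card {i\<in>I. m j + n j \<le> m i + n i}) \<le> size (filter_mset (\<lambda>s. m j + n j \<le> s) S)"
      using insert.prems(2)[of "m j + n j", unfolded card_insert empty] mn by simp
    then have "filter_mset (\<lambda>s. m j + n j \<le> s) S \<noteq> {#}"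
      by (metis not_less_eq_eq le0 size_empty)
    then obtain p where "p \<in># S" and p: "m j + n j \<le> p"
      by (auto simp: filter_mset_eq_conv)
    then obtain S' where S: "S = add_mset p S'"
      by (meson multi_member_split)
    have "\<exists>F. image_mset num_edges F = add_mset (m j) (add_mset (n j) S') \<and>
      prod_mset (image_mset plane_plucking_poly F) = (\<Prod>i\<in>I. qbinom (m i) (n i))"
    proof (rule insert.IH)
      fix x :: nat assume x: "x \<ge> 2"
      show "card {i\<in>I. x \<le> m i + n i} \<le> card {i\<in>I. x \<le> m i} + card {i\<in>I. x \<le> n i} +
          size (filter_mset (\<lambda>s. x \<le> s) (add_mset (m j) (add_mset (n j) S')))"
      \<comment> \<open>Up to \<open>m j + n j\<close>, losing slot \<open>p\<close> offsets the
        loss of \<open>j\<close> on the left, and the new slots replace the terms of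
        \<open>j\<close> on the right.\<close>
      proof (cases "x \<le> m j + n j")
        case True
        then show ?thesis
          using insert.prems(2)[OF x, unfolded card_insert] p by (simp add: S split: if_splits)
      next
        case False
        then have "{i\<in>I. x \<le> m i + n i} = {}"
          using insert.hyps(2) by fastforce
        then show ?thesis by (simp only: card.empty)
      qed
    qed (use insert.prems(1) in auto)
    then obtain F where F: "image_mset num_edges F = add_mset (m j) (add_mset (n j) S')"
      and F_prod: "prod_mset (image_mset plane_plucking_poly F) = (\<Prod>i\<in>I. qbinom (m i) (n i))"
      by blast
    from F obtain a F1 where F1: "F = add_mset a F1" "num_edges a = m j"
        "image_mset num_edges F1 = add_mset (n j) S'"
      by (auto dest!: msed_map_invR)
    from F1(3) obtain b F2 where F2: "F1 = add_mset b F2" "num_edges b = n j"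
        "image_mset num_edges F2 = S'"
      by (auto dest!: msed_map_invR)
    obtain ts us where ab: "a = Node ts" "b = Node us"
      by (meson plane_tree.exhaust)
    have "num_edges (Node (ts @ us)) \<le> p"
      using F1 F2 ab p by simp
    then obtain u where u: "num_edges u = p"
        "plane_plucking_poly u = plane_plucking_poly (Node (ts @ us))"
      using stem_exists by blast
    have "plane_plucking_poly u =
        qbinom (m j) (n j) * (plane_plucking_poly a * plane_plucking_poly b)"
      using u(2) plane_plucking_poly_append[of ts us] F1(2) F2(2) ab by simp
    then show ?thesis
      using F_prod F1(1) F2(1,3) u(1) j insert.hyps(1) S
      by (intro exI[of _ "add_mset u F2"]) (simp add: mult_ac)
  qed
qed

theorem theorem5p6:
  fixes k :: nat and m n :: "nat \<Rightarrow> nat" and P :: "int poly"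
  assumes "k \<ge> 1"
    and "\<forall>i\<in>{1..k}. m i \<ge> 1 \<and> n i \<ge> 1"
    and "P = (\<Prod>i=1..k. qbinom (m i) (n i))"
  shows "(\<exists>T. plucking_poly T = P) \<longleftrightarrow> repeats_no_qint (numerator P)"
proof
  assume "\<exists>T. plucking_poly T = P"
  then obtain t where t: "plane_plucking_poly t = P"
    unfolding plucking_poly_def by blast
  have "P * qint_prod (hooks (forget_embedding t)) = qint_prod (mset_set {1..num_edges t})"
    using plane_plucking_poly_hook_prod[of t] by (simp add: t hook_prod_def qfact_eq_qint_prod)
  then show "repeats_no_qint (numerator P)"
    by (subst repeats_no_qint_numerator_iff) (auto simp: hooks_pos count_mset_set')
next
  assume *: "repeats_no_qint (numerator P)"
  \<comment> \<open>Indices of the numerator and denominator before cancellation.\<close>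
  define C where "C = (\<Sum>i=1..k. mset_set {1..m i + n i})"
  define D where "D = (\<Sum>i=1..k. mset_set {1..m i} + mset_set {1..n i})"
  have qint_prod_sum: "qint_prod (\<Sum>i=1..k. f i) = (\<Prod>i=1..k. qint_prod (f i))" for f
    by (induction k) (simp_all add: qint_prod_add, simp add: qint_prod_def)
  have "P * qint_prod D = qint_prod C"
    unfolding C_def D_def assms(3) qint_prod_sum qint_prod_add qfact_eq_qint_prod[symmetric]
    by (simp add: prod.distrib[symmetric] qbinom_mult_qfact)
  moreover have "0 \<notin># C" "0 \<notin># D"
    by (auto simp: C_def D_def set_mset_sum)
  ultimately have CD: "\<forall>a\<ge>2. count C a \<le> count D a + 1"
    using * by (simp add: repeats_no_qint_numerator_iff)
  \<comment> \<open>\<open>N\<close> bounds every \<open>m i + n i\<close>, and its slot supplies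
    the \<open>+ 1\<close> of \<open>CD\<close> for all \<open>x \<le> N\<close>.\<close>
  define N where "N = (\<Sum>i=1..k. m i + n i)"
  have count: "(\<Sum>i=1..k. count (mset_set {1..f i}) a) = card {i\<in>{1..k}. a \<le> f i}"
    if "a \<ge> 2" for a and f :: "nat \<Rightarrow> nat"
  proof -
    have "card {i\<in>{1..k}. a \<le> f i} = (\<Sum>i=1..k. if a \<le> f i then 1 else 0)"
      by (simp only: card_eq_sum sum.inter_filter[OF finite_atLeastAtMost])
    then show ?thesis
      using that by (simp add: count_mset_set')
  qed
  have "\<exists>F. image_mset num_edges F = {#N#} \<and>
      prod_mset (image_mset plane_plucking_poly F) = (\<Prod>i=1..k. qbinom (m i) (n i))"
  proof (rule trees_fill_slots)
    fix x :: nat assume x: "x \<ge> 2"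
    show "card {i\<in>{1..k}. x \<le> m i + n i} \<le> card {i\<in>{1..k}. x \<le> m i} +
        card {i\<in>{1..k}. x \<le> n i} + size (filter_mset (\<lambda>s. x \<le> s) {#N#})"
    proof (cases "x \<le> N")
      case True
      then show ?thesis
        using CD[rule_format, OF x]
        unfolding C_def D_def count_sum count_union sum.distrib count[OF x] by simp
    next
      case False
      have "m i + n i \<le> N" if "i \<in> {1..k}" for i
        unfolding N_def by (rule member_le_sum) (use that in auto)
      then have "{i\<in>{1..k}. x \<le> m i + n i} = {}"
        using False by fastforce
      then show ?thesis by (simp only: card.empty)
    qed
  qed (use assms(2) in auto)
  then obtain t where "plane_plucking_poly t = P"
    unfolding assms(3) by (auto dest!: msed_map_invR)
  then show "\<exists>T. plucking_poly T = P"
    using plucking_poly_forget_embedding by blast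
qed

end
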